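(* Let $m\ge2$, $d\ge1$ be integers. For $U\in C\ell^{\frac1m}_d$ put $\underline{U}:=2\langle U\rangle_0-U$. Then for all $U,V\in C\ell^{\frac1m}_d$ and all $\alpha\in\mathbb{C}$: $$\underline{\underline{U}}=U,\qquad\underline{U+V}=\underline{U}+\underline{V},\qquad\underline{\alpha U}=\alpha\underline{U},$$ $$\underline{UV}\,U=U\,\underline{VU},$$ $$\underline{U\underline{V}}=\underline{U}\,\underline{V}+\underline{U}V-\underline{UV}.$$
   Context: The generalized Clifford algebra $C\ell^{\frac1m}_d$ is the unital associative algebra over $\mathbb{C}$ with identity $e$ and generators $e_1,\dots,e_d$ subject to $e_j^m=e$ for $j=1,\dots,d$ and $e_ke_l=\omega e_le_k$ for $k<l$, where $\omega:=e^{2\pi i/m}$. It has dimension $m^d$ with basis $e_1^{j_1}\cdots e_d^{j_d}$, $0\le j_1,\dots,j_d\le m-1$, so each element is uniquely $U=\sum u_{j_1\ldots j_d}e_1^{j_1}\cdots e_d^{j_d}$ with $u_{j_1\ldots j_d}\in\mathbb{C}$. Scalars $c\in\mathbb{C}$ are identified with $ce$. The projection onto grade $0$ is $\langle U\rangle_0:=u_{0\ldots0}e\equiv u_{0\ldots0}\in\mathbb{C}$. In expressions such as $\underline{UV}\,U$, the operation $\underline{\phantom{U}}$ is applied to the product $UV$ only; $\underline{U\underline{V}}$ is the operation applied to the product $U\,\underline{V}$. *)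

theory Defs
  imports Complex_Main "HOL-Library.FuncSet" "HOL-Library.Poly_Mapping" "HOL-Algebra.QuotRing"
begin

datatype word = Word (letters: "nat list")

instantiation word :: monoid_add
begin

definition zero_word :: word where
  "0 = Word []"

definition plus_word :: "word \<Rightarrow> word \<Rightarrow> word" where
  "v + w = Word (letters v @ letters w)"

instance
  by standard (simp_all add: zero_word_def plus_word_def)

end

text \<open>
  The library's multiplication on finitely supported functions is the convolution over the addition
  of the key type, here concatenation of words.  So \<^typ>\<open>word \<Rightarrow>\<^sub>0 complex\<close> is the free unital
  associative complex algebra on letters $1, 2, \dots$ and 0, and those elements whose words only
  use the letters $1, \dots, d$ form the free algebra on $d$ generators.
\<close>

definition free_alg :: "nat \<Rightarrow> (word \<Rightarrow>\<^sub>0 complex) ring" where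
  "free_alg d = \<lparr>carrier = {p. \<forall>w \<in> Poly_Mapping.keys p. set (letters w) \<subseteq> {1..d}},
     mult = (*), one = 1, zero = 0, add = (+)\<rparr>"

definition letter :: "nat \<Rightarrow> word \<Rightarrow>\<^sub>0 complex" where
  "letter k = Poly_Mapping.single (Word [k]) 1"

definition const :: "complex \<Rightarrow> word \<Rightarrow>\<^sub>0 complex" where
  "const c = Poly_Mapping.single 0 c"

definition omega :: "nat \<Rightarrow> complex" where
  "omega m = exp (2 * of_real pi * \<i> / of_nat m)"

definition gca_relators :: "nat \<Rightarrow> nat \<Rightarrow> (word \<Rightarrow>\<^sub>0 complex) set" where
  "gca_relators m d =
     {letter j ^ m - 1 |j. j \<in> {1..d}} \<union>
     {letter k * letter l - const (omega m) * letter l * letter k |k l.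
        k \<in> {1..d} \<and> l \<in> {1..d} \<and> k < l}"

definition gca_ideal :: "nat \<Rightarrow> nat \<Rightarrow> (word \<Rightarrow>\<^sub>0 complex) set" where
  "gca_ideal m d = Idl\<^bsub>free_alg d\<^esub> (gca_relators m d)"

definition gca :: "nat \<Rightarrow> nat \<Rightarrow> (word \<Rightarrow>\<^sub>0 complex) set ring" where
  "gca m d = free_alg d Quot gca_ideal m d"

definition gca_gen :: "nat \<Rightarrow> nat \<Rightarrow> nat \<Rightarrow> (word \<Rightarrow>\<^sub>0 complex) set" where
  "gca_gen m d k = gca_ideal m d +>\<^bsub>free_alg d\<^esub> letter k"

text \<open>The scalar \<open>c\<close> identified with \<open>c\<close> times the identity.\<close>

definition gca_scalar :: "nat \<Rightarrow> nat \<Rightarrow> complex \<Rightarrow> (word \<Rightarrow>\<^sub>0 complex) set" where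
  "gca_scalar m d c = gca_ideal m d +>\<^bsub>free_alg d\<^esub> const c"

definition gca_smult ::
  "nat \<Rightarrow> nat \<Rightarrow> complex \<Rightarrow> (word \<Rightarrow>\<^sub>0 complex) set \<Rightarrow> (word \<Rightarrow>\<^sub>0 complex) set" where
  "gca_smult m d c U = gca_scalar m d c \<otimes>\<^bsub>gca m d\<^esub> U"

definition gca_exponents :: "nat \<Rightarrow> nat \<Rightarrow> (nat \<Rightarrow> nat) set" where
  "gca_exponents m d = {1..d} \<rightarrow>\<^sub>E {0..m - 1}"

text \<open>The monomial $e_1^{j_1} \cdots e_d^{j_d}$, with the factors in this order.\<close>

definition gca_monomial :: "nat \<Rightarrow> nat \<Rightarrow> (nat \<Rightarrow> nat) \<Rightarrow> (word \<Rightarrow>\<^sub>0 complex) set" where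
  "gca_monomial m d j =
     foldr (\<lambda>k x. (gca_gen m d k [^]\<^bsub>gca m d\<^esub> j k) \<otimes>\<^bsub>gca m d\<^esub> x) [1..<Suc d] \<one>\<^bsub>gca m d\<^esub>"

text \<open>
  The coordinates of \<open>U\<close> in the monomial basis.  The extensional function space makes them unique
  also as a function on all of \<^typ>\<open>nat \<Rightarrow> nat\<close>.
\<close>

definition gca_coeffs :: "nat \<Rightarrow> nat \<Rightarrow> (word \<Rightarrow>\<^sub>0 complex) set \<Rightarrow> (nat \<Rightarrow> nat) \<Rightarrow> complex" where
  "gca_coeffs m d U =
     (THE u. u \<in> gca_exponents m d \<rightarrow>\<^sub>E UNIV \<and>
        U = (\<Oplus>\<^bsub>gca m d\<^esub> j \<in> gca_exponents m d. gca_smult m d (u j) (gca_monomial m d j)))"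

definition grade0 :: "nat \<Rightarrow> nat \<Rightarrow> (word \<Rightarrow>\<^sub>0 complex) set \<Rightarrow> complex" where
  "grade0 m d U = gca_coeffs m d U (\<lambda>k \<in> {1..d}. 0)"

definition underline :: "nat \<Rightarrow> nat \<Rightarrow> (word \<Rightarrow>\<^sub>0 complex) set \<Rightarrow> (word \<Rightarrow>\<^sub>0 complex) set" where
  "underline m d U = gca_scalar m d (2 * grade0 m d U) \<ominus>\<^bsub>gca m d\<^esub> U"

end

theory Submission
  imports Defs "HOL-Library.Multiset"
begin

text \<open>
  Sorting a word and reducing its letter counts modulo \<open>m\<close> turns it, in the quotient, into
  \<open>\<omega>\<^sup>-\<^sup>i\<close> times a basis monomial, where \<open>i\<close> is the number of inversions.  The linear
  functionals on the free algebra that read off these coordinates annihilate the relators between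
  arbitrary factors, hence the whole ideal, so the monomials are a basis of the quotient and
  \<open>\<langle>\<cdot>\<rangle>\<^sub>0\<close> is induced by one of these functionals.  That functional is invariant under cyclic
  rotation of words, so \<open>\<langle>U V\<rangle>\<^sub>0 = \<langle>V U\<rangle>\<^sub>0\<close>.  The identities then follow from this and
  linearity, and hold already for representatives in the free algebra.
\<close>

subsection \<open>Linear extension to finitely supported functions\<close>

lemma poly_mapping_sum_single:
  fixes p :: "'a \<Rightarrow>\<^sub>0 'b::comm_monoid_add"
  shows "(\<Sum>w\<in>Poly_Mapping.keys p. Poly_Mapping.single w (Poly_Mapping.lookup p w)) = p"
  by (rule poly_mapping_eqI)
    (simp add: lookup_sum lookup_single when_def in_keys_iff sum.delta)

text \<open>\<open>p\<close> is the sum of its terms. The support condition in the single case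
  preserves what is known about the keys of \<open>p\<close>; \<open>gca_class_expansion\<close>
  uses it for the letters of a word.\<close>

lemma poly_mapping_add_induct [case_names zero single add]:
  fixes p :: "'a \<Rightarrow>\<^sub>0 'b::comm_monoid_add"
  assumes "P 0" and "\<And>w c. w \<in> Poly_Mapping.keys p \<Longrightarrow> P (Poly_Mapping.single w c)"
    and "\<And>q r. P q \<Longrightarrow> P r \<Longrightarrow> P (q + r)"
  shows "P p"
proof -
  have "P (\<Sum>w\<in>S. Poly_Mapping.single w (Poly_Mapping.lookup p w))"
    if "S \<subseteq> Poly_Mapping.keys p" "finite S" for S
    using that(2,1) by induction (auto intro: assms)
  from this[OF order.refl finite_keys] show ?thesis by (simp add: poly_mapping_sum_single)
qed

definition lin_ext :: "('a \<Rightarrow> complex) \<Rightarrow> ('a \<Rightarrow>\<^sub>0 complex) \<Rightarrow> complex" where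
  "lin_ext f p = (\<Sum>w\<in>Poly_Mapping.keys p. Poly_Mapping.lookup p w * f w)"

lemma lin_ext_superset:
  assumes "finite S" "Poly_Mapping.keys p \<subseteq> S"
  shows "lin_ext f p = (\<Sum>w\<in>S. Poly_Mapping.lookup p w * f w)"
  unfolding lin_ext_def using assms
  by (intro sum.mono_neutral_left) (auto simp: in_keys_iff)

lemma lin_ext_0 [simp]: "lin_ext f 0 = 0"
  by (simp add: lin_ext_def)

lemma lin_ext_single [simp]: "lin_ext f (Poly_Mapping.single w c) = c * f w"
  by (subst lin_ext_superset[of "{w}"]) auto

lemma lin_ext_add: "lin_ext f (p + q) = lin_ext f p + lin_ext f q"
proof -
  let ?S = "Poly_Mapping.keys p \<union> Poly_Mapping.keys q"
  have "finite ?S" by simp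
  then show ?thesis
    using Poly_Mapping.keys_add[of p q]
    by (simp add: lin_ext_superset[of ?S] lookup_add distrib_right sum.distrib)
qed

lemma lin_ext_uminus: "lin_ext f (- p) = - lin_ext f p"
  using lin_ext_add[of f p "- p"] by (simp add: eq_neg_iff_add_eq_0 add.commute)

lemma lin_ext_diff: "lin_ext f (p - q) = lin_ext f p - lin_ext f q"
  using lin_ext_add[of f p "- q"] by (simp add: lin_ext_uminus)

lemma lin_ext_sum: "lin_ext f (\<Sum>i\<in>S. g i) = (\<Sum>i\<in>S. lin_ext f (g i))"
  by (induction S rule: infinite_finite_induct) (simp_all add: lin_ext_add)

lemma lin_ext_const_mult: "lin_ext f (const c * p) = c * lin_ext f p"
  by (induction p rule: poly_mapping_add_induct)
    (simp_all add: lin_ext_add const_def distrib_left mult_single)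

text \<open>The key \<open>0\<close> is neutral for concatenation on either side, so scalars are
  central in an otherwise noncommutative product.\<close>

lemma const_mult_commute: "const c * p = p * const c"
  by (induction p rule: poly_mapping_add_induct)
    (simp_all add: const_def distrib_left distrib_right mult_single mult.commute)

subsection \<open>Inversions and the weight of a word\<close>

primrec inversions :: "'a::linorder list \<Rightarrow> nat" where
  "inversions [] = 0"
| "inversions (x # xs) = length (filter (\<lambda>y. y < x) xs) + inversions xs"

text \<open>Only the pair \<open>l\<close>, \<open>k\<close> changes its order; every other letter
  keeps the same multiset of letters to its right.\<close>

lemma inversions_swap:
  "k < l \<Longrightarrow> inversions (us @ l # k # vs) = Suc (inversions (us @ k # l # vs))"
  by (induction us) auto

lemma inversions_sorted: "sorted xs \<Longrightarrow> inversions xs = 0"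
  by (induction xs) (auto simp: filter_empty_conv not_less)

lemma inversions_replicate:
  "inversions (replicate n k @ vs) = n * length (filter (\<lambda>y. y < k) vs) + inversions vs"
  by (induction n) auto

text \<open>Each letter outside the block forms 0 or \<open>m\<close> inversions with it, and the
  block has none of its own.\<close>

lemma inversions_replicate_mod:
  "inversions (us @ replicate m k @ vs) mod m = inversions (us @ vs) mod m"
proof (induction us)
  case Nil
  then show ?case by (simp add: inversions_replicate)
next
  case (Cons x us)
  have "length (filter (\<lambda>y. y < x) (us @ replicate m k @ vs)) mod m =
      length (filter (\<lambda>y. y < x) (us @ vs)) mod m"
    by (cases "k < x") (simp_all add: filter_replicate add.left_commute)
  from mod_add_cong[OF this Cons.IH] show ?case by simp
qed

lemma inversions_snoc: "inversions (xs @ [k]) = length (filter (\<lambda>y. k < y) xs) + inversions xs"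
  by (induction xs) auto

text \<open>The filtered length is the sum of the counts of the distinct letters satisfying
  \<open>P\<close>.\<close>

lemma length_filter_mod_0:
  assumes "\<And>y. P y \<Longrightarrow> count_list xs y mod m = 0"
  shows "length (filter P xs) mod m = 0"
proof -
  have "length (filter P xs) = (\<Sum>y\<in>set (filter P xs). count_list (filter P xs) y)"
    by (simp add: sum_count_set)
  also have "\<dots> = (\<Sum>y\<in>set (filter P xs). count_list xs y)"
    by (intro sum.cong refl) (auto simp: count_list_eq_length_filter intro!: arg_cong[of _ _ length] filter_cong)
  finally show ?thesis
    using assms by (auto simp: mod_eq_0_iff_dvd intro!: dvd_sum)
qed

text \<open>
  \<open>weight m r w\<close> is the coordinate of the word \<open>w\<close> at the basis monomial with exponents \<open>r\<close>:
  moving \<open>e\<^sub>l\<close> past \<open>e\<^sub>k\<close> with \<open>k < l\<close> costs a factor \<open>\<omega>\<^sup>-\<^sup>1\<close>.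
\<close>

definition weight :: "nat \<Rightarrow> (nat \<Rightarrow> nat) \<Rightarrow> word \<Rightarrow> complex" where
  "weight m r w = (if (\<lambda>k. count_list (letters w) k mod m) = r
     then inverse (omega m) ^ inversions (letters w) else 0)"

lemma omega_nonzero [simp]: "omega m \<noteq> 0"
  by (simp add: omega_def)

lemma omega_power: "0 < m \<Longrightarrow> omega m ^ m = 1"
  by (simp add: omega_def flip: exp_of_nat_mult)

lemma inverse_omega_power_cong:
  assumes "0 < m" "a mod m = b mod m"
  shows "inverse (omega m) ^ a = inverse (omega m) ^ b"
proof -
  have *: "inverse (omega m) ^ n = inverse (omega m) ^ (n mod m)" for n
  proof -
    have "inverse (omega m) ^ n = inverse (omega m) ^ (m * (n div m) + n mod m)" by simp
    also have "\<dots> = inverse (omega m) ^ (n mod m)"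
      unfolding power_add power_mult using assms(1) by (simp add: power_inverse omega_power)
    finally show ?thesis .
  qed
  show ?thesis using *[of a] *[of b] assms(2) by simp
qed

text \<open>The weights respect the relation between \<open>e_k\<close> and \<open>e_l\<close>:
  letter counts agree and the right-hand word has one inversion more, which the factor \<omega>
  compensates.\<close>

lemma weight_swap:
  assumes "k < l"
  shows "weight m r (Word (us @ k # l # vs)) = omega m * weight m r (Word (us @ l # k # vs))"
proof -
  have "count_list (us @ k # l # vs) = count_list (us @ l # k # vs)"
    by (rule ext) simp
  then show ?thesis
    using assms by (simp only: weight_def word.sel inversions_swap) simp
qed

text \<open>The weights respect the relation \<open>e_k^m = e\<close>: counts and inversions both
  change by multiples of \<open>m\<close>, and \<omega> is an \<open>m\<close>-th root of
  unity.\<close>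

lemma weight_replicate:
  assumes "0 < m"
  shows "weight m r (Word (us @ replicate m k @ vs)) = weight m r (Word (us @ vs))"
proof -
  have "count_list (replicate m k) j mod m = 0" for j
    by (cases "j = k") (simp_all add: count_list_eq_length_filter)
  then have "(\<lambda>j. count_list (us @ replicate m k @ vs) j mod m) = (\<lambda>j. count_list (us @ vs) j mod m)"
    by (intro ext) (metis add_0 count_list_append mod_add_cong add.left_commute mod_add_left_eq)
  then show ?thesis
    using inverse_omega_power_cong[OF assms inversions_replicate_mod[of us m k vs]]
    by (simp add: weight_def)
qed

text \<open>
  Moving \<open>k\<close> from the front to the back trades the inversions with smaller letters for those with
  larger letters; both numbers are divisible by \<open>m\<close> when every letter count is.
\<close>

lemma weight_rotate1:
  assumes "0 < m"
  shows "weight m (\<lambda>_. 0) (Word (k # xs)) = weight m (\<lambda>_. 0) (Word (xs @ [k]))"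
proof -
  have counts: "count_list (xs @ [k]) = count_list (k # xs)"
    by (rule ext) simp
  show ?thesis
  proof (cases "(\<lambda>j. count_list (k # xs) j mod m) = (\<lambda>_. 0)")
    case True
    \<comment> \<open>Dropping the leading \<open>k\<close> alters only the count of
      \<open>k\<close>, a letter that neither of the two filters below admits.\<close>
    then have count: "count_list xs j mod m = 0" if "j \<noteq> k" for j
      using that by (metis count_list.simps(2))
    have "length (filter (\<lambda>y. y < k) xs) mod m = 0" "length (filter (\<lambda>y. k < y) xs) mod m = 0"
      by (rule length_filter_mod_0, use count in auto)+
    then have "inversions (k # xs) mod m = inversions (xs @ [k]) mod m"
      unfolding inversions_snoc inversions.simps by (metis mod_add_cong)
    from inverse_omega_power_cong[OF assms this] show ?thesis
      by (simp only: weight_def word.sel counts)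
  next
    case False
    then show ?thesis by (simp only: weight_def word.sel counts if_False)
  qed
qed

text \<open>Rotating one letter at a time carries the whole prefix to the end.\<close>

lemma weight_commute:
  assumes "0 < m"
  shows "weight m (\<lambda>_. 0) (v + w) = weight m (\<lambda>_. 0) (w + v)"
proof -
  have "weight m (\<lambda>_. 0) (Word (xs @ ys)) = weight m (\<lambda>_. 0) (Word (ys @ xs))" for xs ys
  proof (induction xs arbitrary: ys)
    case (Cons x xs)
    show ?case
      using weight_rotate1[OF assms, of x "xs @ ys"] Cons.IH[of "ys @ [x]"] by simp
  qed simp
  then show ?thesis by (simp add: plus_word_def)
qed

text \<open>The trace property; bilinearity reduces it to single words.\<close>

lemma lin_ext_weight_commute:
  assumes "0 < m"
  shows "lin_ext (weight m (\<lambda>_. 0)) (p * q) = lin_ext (weight m (\<lambda>_. 0)) (q * p)"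
proof (induction p rule: poly_mapping_add_induct)
  case (single v a)
  show ?case
  proof (induction q rule: poly_mapping_add_induct)
    case (single w b)
    show ?case
      using weight_commute[OF assms, of v w] by (simp add: mult_single)
  qed (simp_all add: lin_ext_add distrib_left distrib_right)
qed (simp_all add: lin_ext_add distrib_left distrib_right)

subsection \<open>The free algebra and the defining ideal\<close>

lemma single_Word_mult:
  "Poly_Mapping.single (Word xs) a * Poly_Mapping.single (Word ys) b
    = Poly_Mapping.single (Word (xs @ ys)) (a * b :: complex)"
  by (simp add: mult_single plus_word_def)

lemma single_Nil_one: "Poly_Mapping.single (Word []) 1 = (1 :: word \<Rightarrow>\<^sub>0 complex)"
  by (simp flip: zero_word_def)

lemma letter_power: "letter k ^ n = Poly_Mapping.single (Word (replicate n k)) 1"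
  by (induction n) (simp_all add: single_Nil_one single_Word_mult letter_def)

lemma const_mult_single: "const c * Poly_Mapping.single w a = Poly_Mapping.single w (c * a)"
  by (simp add: const_def mult_single)

lemma carrier_free_alg_iff:
  "p \<in> carrier (free_alg d) \<longleftrightarrow> (\<forall>w \<in> Poly_Mapping.keys p. set (letters w) \<subseteq> {1..d})"
  by (simp add: free_alg_def)

lemma free_alg_ops [simp]:
  "x \<otimes>\<^bsub>free_alg d\<^esub> y = x * y" "x \<oplus>\<^bsub>free_alg d\<^esub> y = x + y"
  "\<one>\<^bsub>free_alg d\<^esub> = 1" "\<zero>\<^bsub>free_alg d\<^esub> = 0"
  by (simp_all add: free_alg_def)

lemma single_in_free_alg:
  "set xs \<subseteq> {1..d} \<Longrightarrow> Poly_Mapping.single (Word xs) c \<in> carrier (free_alg d)"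
  by (simp add: carrier_free_alg_iff)

lemma letter_in_free_alg: "k \<in> {1..d} \<Longrightarrow> letter k \<in> carrier (free_alg d)"
  by (simp add: letter_def single_in_free_alg)

lemma const_in_free_alg: "const c \<in> carrier (free_alg d)"
  using single_in_free_alg[of "[]"] by (simp add: const_def zero_word_def)

lemma one_in_free_alg: "1 \<in> carrier (free_alg d)"
  using const_in_free_alg[of 1] by (simp add: const_def)

lemma zero_in_free_alg: "0 \<in> carrier (free_alg d)"
  by (simp add: carrier_free_alg_iff)

lemma add_in_free_alg:
  "p \<in> carrier (free_alg d) \<Longrightarrow> q \<in> carrier (free_alg d) \<Longrightarrow> p + q \<in> carrier (free_alg d)"
  using Poly_Mapping.keys_add[of p q] unfolding carrier_free_alg_iff by blast

lemma uminus_in_free_alg: "p \<in> carrier (free_alg d) \<Longrightarrow> - p \<in> carrier (free_alg d)"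
  by (simp add: carrier_free_alg_iff in_keys_iff)

lemma diff_in_free_alg:
  "p \<in> carrier (free_alg d) \<Longrightarrow> q \<in> carrier (free_alg d) \<Longrightarrow> p - q \<in> carrier (free_alg d)"
  using add_in_free_alg[of p d "- q"] by (simp add: uminus_in_free_alg)

lemma mult_in_free_alg:
  assumes "p \<in> carrier (free_alg d)" "q \<in> carrier (free_alg d)"
  shows "p * q \<in> carrier (free_alg d)"
  using assms Poly_Mapping.keys_mult[of p q] unfolding carrier_free_alg_iff plus_word_def
  by (fastforce dest!: subsetD)

lemma sum_in_free_alg:
  "(\<And>i. i \<in> S \<Longrightarrow> g i \<in> carrier (free_alg d)) \<Longrightarrow> (\<Sum>i\<in>S. g i) \<in> carrier (free_alg d)"
  by (induction S rule: infinite_finite_induct) (auto intro: add_in_free_alg zero_in_free_alg)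

lemmas in_free_alg = single_in_free_alg letter_in_free_alg const_in_free_alg one_in_free_alg
  zero_in_free_alg add_in_free_alg uminus_in_free_alg diff_in_free_alg mult_in_free_alg
  sum_in_free_alg

lemma ring_free_alg: "ring (free_alg d)"
proof (rule ringI)
  show "abelian_group (free_alg d)"
    by (rule abelian_groupI)
      (auto simp: in_free_alg add_ac intro!: bexI[where x = "- x" for x])
  show "Group.monoid (free_alg d)"
    by (rule monoidI) (simp_all add: in_free_alg mult.assoc)
qed (simp_all add: distrib_left distrib_right)

lemma a_inv_free_alg: "p \<in> carrier (free_alg d) \<Longrightarrow> \<ominus>\<^bsub>free_alg d\<^esub> p = - p"
  using ring_free_alg abelian_group.minus_equality[of "free_alg d" "- p" p]
  by (simp add: in_free_alg ring_def)

lemma a_minus_free_alg: "q \<in> carrier (free_alg d) \<Longrightarrow> p \<ominus>\<^bsub>free_alg d\<^esub> q = p - q"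
  by (simp add: a_minus_def a_inv_free_alg)

lemma gca_relators_subset: "gca_relators m d \<subseteq> carrier (free_alg d)"
  by (auto simp: gca_relators_def letter_power in_free_alg set_replicate_conv_if
      intro!: diff_in_free_alg single_in_free_alg split: if_splits)

lemma ideal_gca_ideal: "ideal (gca_ideal m d) (free_alg d)"
  unfolding gca_ideal_def by (rule ring.genideal_ideal[OF ring_free_alg gca_relators_subset])

text \<open>The expression is linear in both outer factors, so it suffices to test scalar multiples
  of words.\<close>

lemma lin_ext_sandwich_eq_0:
  assumes "\<And>us vs a b. lin_ext f (Poly_Mapping.single (Word us) a * p * Poly_Mapping.single (Word vs) b) = 0"
  shows "lin_ext f (q * p * s) = 0"
proof (induction q rule: poly_mapping_add_induct)
  case (single u a)
  show ?case
  proof (induction s rule: poly_mapping_add_induct)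
    case (single v b)
    show ?case using assms[of "letters u" a "letters v" b] by simp
  qed (simp_all add: distrib_left lin_ext_add)
qed (simp_all add: distrib_right lin_ext_add)

lemma lin_ext_weight_relator:
  assumes "0 < m" "p \<in> gca_relators m d"
  shows "lin_ext (weight m r) (q * p * s) = 0"
proof (rule lin_ext_sandwich_eq_0)
  fix us vs a b
  from assms(2) consider j where "p = letter j ^ m - 1"
    | k l where "k < l" "p = letter k * letter l - const (omega m) * letter l * letter k"
    unfolding gca_relators_def by blast
  then show "lin_ext (weight m r)
      (Poly_Mapping.single (Word us) a * p * Poly_Mapping.single (Word vs) b) = 0"
  proof cases
    case 1
    then show ?thesis
      using weight_replicate[OF assms(1), of r us j vs]
      by (simp add: letter_power single_Word_mult lin_ext_diff left_diff_distrib
          right_diff_distrib)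
  next
    case 2
    then show ?thesis
      using weight_swap[of k l m r us vs]
      by (simp add: letter_def const_mult_single single_Word_mult lin_ext_diff left_diff_distrib
          right_diff_distrib)
  qed
qed

lemma lin_ext_weight_gca_ideal:
  assumes "0 < m" "p \<in> gca_ideal m d"
  shows "lin_ext (weight m r) p = 0"
proof -
  interpret ring "free_alg d" by (rule ring_free_alg)
  \<comment> \<open>The kernel of the functional need not be an ideal. Demanding annihilation
    between all factors \<open>q\<close> and \<open>s\<close> makes absorption on either side a
    matter of associativity; \<open>q = s = 1\<close> recovers the kernel.\<close>
  define J where "J = {p \<in> carrier (free_alg d). \<forall>q s. lin_ext (weight m r) (q * p * s) = 0}"
  have "ideal J (free_alg d)"
  proof (rule idealI)
    show "subgroup J (add_monoid (free_alg d))"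
      by (rule add.subgroupI)
        (auto simp: J_def in_free_alg a_inv_free_alg distrib_left distrib_right lin_ext_add
          lin_ext_uminus intro: zero_in_free_alg simp flip: a_inv_def)
    fix a x assume a: "a \<in> J" and x: "x \<in> carrier (free_alg d)"
    have "lin_ext (weight m r) (q * (x * a) * s) = 0"
      "lin_ext (weight m r) (q * (a * x) * s) = 0" for q s
      using a unfolding J_def by (auto simp flip: mult.assoc) (simp add: mult.assoc)
    with a x show "x \<otimes>\<^bsub>free_alg d\<^esub> a \<in> J" "a \<otimes>\<^bsub>free_alg d\<^esub> x \<in> J"
      by (simp_all add: J_def in_free_alg)
  qed (rule ring_axioms)
  moreover have "gca_relators m d \<subseteq> J"
    using gca_relators_subset lin_ext_weight_relator[OF assms(1)] by (auto simp: J_def)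
  ultimately have "p \<in> J"
    using genideal_minimal[of J "gca_relators m d"] assms(2) by (auto simp: gca_ideal_def)
  then have "lin_ext (weight m r) (1 * p * 1) = 0"
    unfolding J_def by blast
  then show ?thesis by simp
qed

subsection \<open>Reduction of words to basis monomials in the quotient\<close>

abbreviation gca_class :: "nat \<Rightarrow> nat \<Rightarrow> (word \<Rightarrow>\<^sub>0 complex) \<Rightarrow> (word \<Rightarrow>\<^sub>0 complex) set" where
  "gca_class m d p \<equiv> gca_ideal m d +>\<^bsub>free_alg d\<^esub> p"

lemma ring_hom_ring_gca_class: "ring_hom_ring (free_alg d) (gca m d) (gca_class m d)"
  unfolding gca_def by (rule ideal.rcos_ring_hom_ring[OF ideal_gca_ideal])

lemma ring_gca: "ring (gca m d)"
  unfolding gca_def by (rule ideal.quotient_is_ring[OF ideal_gca_ideal])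

lemma gca_class_cases:
  assumes "U \<in> carrier (gca m d)"
  obtains p where "p \<in> carrier (free_alg d)" "U = gca_class m d p"
  using assms by (auto simp: gca_def FactRing_def A_RCOSETS_def')

lemma gca_class_closed: "p \<in> carrier (free_alg d) \<Longrightarrow> gca_class m d p \<in> carrier (gca m d)"
  by (rule ring_hom_closed[OF ring_hom_ring.homh[OF ring_hom_ring_gca_class]])

lemma gca_class_mult:
  assumes "p \<in> carrier (free_alg d)" "q \<in> carrier (free_alg d)"
  shows "gca_class m d p \<otimes>\<^bsub>gca m d\<^esub> gca_class m d q = gca_class m d (p * q)"
  using ring_hom_mult[OF ring_hom_ring.homh[OF ring_hom_ring_gca_class] assms] by simp

lemma gca_class_add:
  assumes "p \<in> carrier (free_alg d)" "q \<in> carrier (free_alg d)"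
  shows "gca_class m d p \<oplus>\<^bsub>gca m d\<^esub> gca_class m d q = gca_class m d (p + q)"
  using ring_hom_add[OF ring_hom_ring.homh[OF ring_hom_ring_gca_class] assms] by simp

lemma gca_class_minus:
  assumes "p \<in> carrier (free_alg d)" "q \<in> carrier (free_alg d)"
  shows "gca_class m d p \<ominus>\<^bsub>gca m d\<^esub> gca_class m d q = gca_class m d (p - q)"
proof -
  interpret ring_hom_ring "free_alg d" "gca m d" "gca_class m d"
    by (rule ring_hom_ring_gca_class)
  have "gca_class m d (- q) = \<ominus>\<^bsub>gca m d\<^esub> gca_class m d q"
    using hom_a_inv[OF assms(2)] by (simp add: a_inv_free_alg assms(2))
  then show ?thesis
    using gca_class_add[of p d "- q" m] assms by (simp add: a_minus_def in_free_alg)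
qed

lemma gca_class_one: "\<one>\<^bsub>gca m d\<^esub> = gca_class m d 1"
  using ring_hom_one[OF ring_hom_ring.homh[OF ring_hom_ring_gca_class]] by simp

lemma gca_class_zero: "\<zero>\<^bsub>gca m d\<^esub> = gca_class m d 0"
proof -
  interpret ring_hom_ring "free_alg d" "gca m d" "gca_class m d"
    by (rule ring_hom_ring_gca_class)
  show ?thesis using hom_zero by simp
qed

lemma gca_class_eq_iff:
  assumes "p \<in> carrier (free_alg d)" "q \<in> carrier (free_alg d)"
  shows "gca_class m d p = gca_class m d q \<longleftrightarrow> p - q \<in> gca_ideal m d"
  using ring.quotient_eq_iff_same_a_r_cos[OF ring_free_alg ideal_gca_ideal assms]
  by (simp add: a_minus_free_alg assms)

lemma gca_class_finsum:
  assumes "finite S" "\<And>i. i \<in> S \<Longrightarrow> g i \<in> carrier (free_alg d)"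
  shows "(\<Oplus>\<^bsub>gca m d\<^esub> i \<in> S. gca_class m d (g i)) = gca_class m d (\<Sum>i\<in>S. g i)"
proof -
  interpret ring "gca m d" by (rule ring_gca)
  from assms show ?thesis
    by (induction S rule: finite_induct)
      (auto simp: gca_class_zero gca_class_closed gca_class_add in_free_alg Pi_iff)
qed

text \<open>Membership of \<open>p ^ n\<close> is carried along because the induction step
  multiplies classes and needs representatives in the carrier.\<close>

lemma gca_class_nat_pow:
  assumes "p \<in> carrier (free_alg d)"
  shows "gca_class m d p [^]\<^bsub>gca m d\<^esub> (n::nat) = gca_class m d (p ^ n) \<and> p ^ n \<in> carrier (free_alg d)"
proof -
  interpret ring "gca m d" by (rule ring_gca)
  show ?thesis
    by (induction n)
      (auto simp: gca_class_one gca_class_mult in_free_alg assms power_commutes)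
qed

section \<open>Words representing the ordered monomials\<close>

definition normal_word :: "nat list \<Rightarrow> (nat \<Rightarrow> nat) \<Rightarrow> nat list" where
  "normal_word ks j = concat (map (\<lambda>k. replicate (j k) k) ks)"

lemma normal_word_simps [simp]:
  "normal_word [] j = []"
  "normal_word (k # ks) j = replicate (j k) k @ normal_word ks j"
  by (simp_all add: normal_word_def)

lemma set_normal_word: "set (normal_word ks j) \<subseteq> set ks"
  by (induction ks) (auto simp: set_replicate_conv_if)

lemma sorted_normal_word: "sorted ks \<Longrightarrow> sorted (normal_word ks j)"
  using set_normal_word[of _ j]
  by (induction ks) (auto simp: sorted_append set_replicate_conv_if)

lemma count_normal_word:
  "distinct ks \<Longrightarrow> count_list (normal_word ks j) k = (if k \<in> set ks then j k else 0)"
proof (induction ks)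
  case (Cons x ks)
  have "count_list (replicate n x) k = (if x = k then n else 0)" for n
    by (induction n) auto
  with Cons show ?case by auto
qed simp

lemma normal_word_cong: "(\<And>k. k \<in> set ks \<Longrightarrow> i k = j k) \<Longrightarrow> normal_word ks i = normal_word ks j"
  by (induction ks) auto

text \<open>A sorted list is determined by its multiset of entries, and both sides have the letter
  counts of \<open>xs\<close>.\<close>

lemma sort_eq_normal_word:
  assumes "sorted ks" "distinct ks" "set xs \<subseteq> set ks"
  shows "sort xs = normal_word ks (count_list xs)"
proof (rule properties_for_sort)
  show "mset (normal_word ks (count_list xs)) = mset xs"
    using assms by (intro multiset_eqI) (auto simp: count_mset count_normal_word count_list_0_iff)
qed (use assms in \<open>auto simp: sorted_normal_word\<close>)

definition basis_word :: "nat \<Rightarrow> (nat \<Rightarrow> nat) \<Rightarrow> nat list" where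
  "basis_word d j = normal_word [1..<Suc d] j"

lemma set_basis_word: "set (basis_word d j) \<subseteq> {1..d}"
  using set_normal_word[of "[1..<Suc d]" j]
  by (simp add: basis_word_def atLeastLessThanSuc_atLeastAtMost del: upt_Suc)

lemma sorted_basis_word: "sorted (basis_word d j)"
  by (simp add: basis_word_def sorted_normal_word del: upt_Suc)

lemma count_basis_word: "count_list (basis_word d j) k = (if k \<in> {1..d} then j k else 0)"
  by (simp add: basis_word_def count_normal_word atLeastLessThanSuc_atLeastAtMost del: upt_Suc)

lemma basis_word_cong: "(\<And>k. k \<in> {1..d} \<Longrightarrow> i k = j k) \<Longrightarrow> basis_word d i = basis_word d j"
  unfolding basis_word_def
  by (rule normal_word_cong) (simp add: atLeastLessThanSuc_atLeastAtMost del: upt_Suc)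

lemma gca_monomial_eq:
  "gca_monomial m d j = gca_class m d (Poly_Mapping.single (Word (basis_word d j)) 1)"
proof -
  \<comment> \<open>The list of generators is generalized to \<open>ks\<close> so that induction
    follows the recursion of \<open>foldr\<close>.\<close>
  have "foldr (\<lambda>k x. (gca_gen m d k [^]\<^bsub>gca m d\<^esub> j k) \<otimes>\<^bsub>gca m d\<^esub> x) ks \<one>\<^bsub>gca m d\<^esub>
      = gca_class m d (Poly_Mapping.single (Word (normal_word ks j)) 1)"
    if "set ks \<subseteq> {1..d}" for ks
    using that
  proof (induction ks)
    case Nil
    then show ?case by (simp add: gca_class_one single_Nil_one)
  next
    case (Cons k ks)
    have "set (replicate (j k) k) \<subseteq> {1..d}" "set (normal_word ks j) \<subseteq> {1..d}"
      using Cons.prems set_normal_word[of ks j] by (auto simp: set_replicate_conv_if)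
    moreover have "letter k \<in> carrier (free_alg d)"
      using Cons.prems by (simp add: letter_in_free_alg)
    ultimately show ?case
      using Cons
      by (simp add: gca_gen_def gca_class_nat_pow letter_power gca_class_mult single_in_free_alg
          single_Word_mult)
  qed
  from this[of "[1..<Suc d]"] show ?thesis
    by (simp add: gca_monomial_def basis_word_def atLeastLessThanSuc_atLeastAtMost del: upt_Suc)
qed

section \<open>Rewriting words modulo the ideal\<close>

text \<open>Makes a relator \<open>p - q\<close> a rewrite rule inside any product: the classes of
  \<open>p\<close> and \<open>q\<close> coincide, and the quotient map is multiplicative.\<close>

lemma gca_class_relator:
  assumes "p - q \<in> gca_relators m d" "p \<in> carrier (free_alg d)" "q \<in> carrier (free_alg d)"
    "s \<in> carrier (free_alg d)" "t \<in> carrier (free_alg d)"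
  shows "gca_class m d (s * p * t) = gca_class m d (s * q * t)"
proof -
  have "p - q \<in> gca_ideal m d"
    using ring.genideal_self[OF ring_free_alg gca_relators_subset] assms(1)
    unfolding gca_ideal_def by blast
  then have "gca_class m d p = gca_class m d q"
    using gca_class_eq_iff assms by simp
  then show ?thesis
    using assms by (simp add: in_free_alg flip: gca_class_mult)
qed

lemma gca_class_swap:
  assumes "k < l" "set (us @ l # k # vs) \<subseteq> {1..d}"
  shows "gca_class m d (Poly_Mapping.single (Word (us @ l # k # vs)) c) =
    gca_class m d (Poly_Mapping.single (Word (us @ k # l # vs)) (c * inverse (omega m)))"
proof -
  have rel: "letter k * letter l - const (omega m) * letter l * letter k \<in> gca_relators m d"
    unfolding gca_relators_def using assms by (intro UnI2 CollectI exI[of _ k] exI[of _ l]) simp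
  \<comment> \<open>The inverse of \<omega> is put into the left factor so that it cancels the
    \<omega> of the relator on the side of \<open>l\<close>, \<open>k\<close>.\<close>
  have "gca_class m d (Poly_Mapping.single (Word us) (c * inverse (omega m))
        * (letter k * letter l) * Poly_Mapping.single (Word vs) 1)
      = gca_class m d (Poly_Mapping.single (Word us) (c * inverse (omega m))
        * (const (omega m) * letter l * letter k) * Poly_Mapping.single (Word vs) 1)"
    by (rule gca_class_relator[OF rel]) (use assms in \<open>auto intro!: in_free_alg\<close>)
  then show ?thesis
    by (simp add: letter_def const_mult_single single_Word_mult mult.assoc)
qed

text \<open>\<open>k\<close> moves right past each smaller letter at the cost of one inverse
  \<omega>. The prefix \<open>us\<close> is arbitrary because it absorbs each letter passed.\<close>

lemma gca_class_insort:
  assumes "sorted xs" "set us \<subseteq> {1..d}" "set (k # xs) \<subseteq> {1..d}"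
  shows "gca_class m d (Poly_Mapping.single (Word (us @ k # xs)) c) =
    gca_class m d (Poly_Mapping.single (Word (us @ insort k xs))
      (c * inverse (omega m) ^ length (filter (\<lambda>y. y < k) xs)))"
  using assms
proof (induction xs arbitrary: us c)
  case (Cons x xs)
  show ?case
  proof (cases "k \<le> x")
    case True
    with Cons.prems have "filter (\<lambda>y. y < k) (x # xs) = []"
      by (auto simp: filter_empty_conv)
    with True show ?thesis by (simp del: filter.simps)
  next
    case False
    then show ?thesis
      using gca_class_swap[of x k us xs d m c] Cons.prems
        Cons.IH[of "us @ [x]" "c * inverse (omega m)"]
      by (simp add: mult.assoc)
  qed
qed simp

text \<open>Insertion sort: the tail is sorted first, then the head is inserted. Sorting the tail
  does not change how many of its letters are smaller than the head, so the exponents add up to the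
  inversions.\<close>

lemma gca_class_sort:
  assumes "set us \<subseteq> {1..d}" "set xs \<subseteq> {1..d}"
  shows "gca_class m d (Poly_Mapping.single (Word (us @ xs)) c) =
    gca_class m d (Poly_Mapping.single (Word (us @ sort xs)) (c * inverse (omega m) ^ inversions xs))"
  using assms
proof (induction xs arbitrary: us c)
  case (Cons x xs)
  have "length (filter (\<lambda>y. y < x) (sort xs)) = length (filter (\<lambda>y. y < x) xs)"
    by (metis mset_filter mset_sort size_mset)
  then show ?case
    using Cons.IH[of "us @ [x]" c] Cons.prems
      gca_class_insort[of "sort xs" us d x m "c * inverse (omega m) ^ inversions xs"]
    by (simp add: power_add mult_ac)
qed simp

lemma gca_class_replicate_mod:
  assumes "k \<in> {1..d}" "set us \<subseteq> {1..d}" "set vs \<subseteq> {1..d}"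
  shows "gca_class m d (Poly_Mapping.single (Word (us @ replicate n k @ vs)) c) =
    gca_class m d (Poly_Mapping.single (Word (us @ replicate (n mod m) k @ vs)) c)"
proof -
  have rel: "letter k ^ m - 1 \<in> gca_relators m d"
    using assms by (auto simp: gca_relators_def)
  have set: "set (replicate i k) \<subseteq> {1..d}" for i
    using assms(1) by (auto simp: set_replicate_conv_if)
  have step: "gca_class m d (Poly_Mapping.single (Word (us @ replicate m k @ ws)) c) =
      gca_class m d (Poly_Mapping.single (Word (us @ ws)) c)" if "set ws \<subseteq> {1..d}" for ws
  proof -
    have "gca_class m d (Poly_Mapping.single (Word us) c * letter k ^ m
          * Poly_Mapping.single (Word ws) 1)
        = gca_class m d (Poly_Mapping.single (Word us) c * 1 * Poly_Mapping.single (Word ws) 1)"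
      by (rule gca_class_relator[OF rel])
        (use assms that set[of m] in \<open>auto simp: letter_power intro!: single_in_free_alg one_in_free_alg\<close>)
    then show ?thesis by (simp add: letter_power single_Word_mult)
  qed
  \<comment> \<open>Blocks of \<open>m\<close> letters are removed one by one,
    \<open>n div m\<close> times.\<close>
  have "gca_class m d (Poly_Mapping.single (Word (us @ replicate (m * q + i) k @ vs)) c) =
    gca_class m d (Poly_Mapping.single (Word (us @ replicate i k @ vs)) c)" for q i
  proof (induction q)
    case (Suc q)
    have "set (replicate (m * q + i) k @ vs) \<subseteq> {1..d}"
      using set[of "m * q + i"] assms(3) by auto
    from step[OF this] Suc show ?case
      by (simp add: replicate_add add.assoc)
  qed simp
  from this[of "n div m" "n mod m"] show ?thesis by simp
qed

text \<open>Blocks are reduced from left to right; each reduced block joins the prefix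
  \<open>us\<close>.\<close>

lemma gca_class_normal_word_mod:
  assumes "set ks \<subseteq> {1..d}" "set us \<subseteq> {1..d}"
  shows "gca_class m d (Poly_Mapping.single (Word (us @ normal_word ks j)) c) =
    gca_class m d (Poly_Mapping.single (Word (us @ normal_word ks (\<lambda>k. j k mod m))) c)"
  using assms
proof (induction ks arbitrary: us)
  case (Cons k ks)
  have "set (replicate (j k mod m) k) \<subseteq> {1..d}" "set (normal_word ks j) \<subseteq> {1..d}"
    using Cons.prems set_normal_word[of ks j] by (auto simp: set_replicate_conv_if)
  then show ?case
    using gca_class_replicate_mod[of k d us "normal_word ks j" m "j k" c]
      Cons.IH[of "us @ replicate (j k mod m) k"] Cons.prems by simp
qed simp

lemma gca_class_word:
  assumes "set xs \<subseteq> {1..d}"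
  shows "gca_class m d (Poly_Mapping.single (Word xs) c) =
    gca_class m d (Poly_Mapping.single (Word (basis_word d (\<lambda>k. count_list xs k mod m)))
      (c * inverse (omega m) ^ inversions xs))"
proof -
  have "sort xs = normal_word [1..<Suc d] (count_list xs)"
    by (rule sort_eq_normal_word)
      (use assms in \<open>simp_all add: atLeastLessThanSuc_atLeastAtMost del: upt_Suc\<close>)
  then show ?thesis
    using gca_class_sort[of "[]" d xs m c] assms
      gca_class_normal_word_mod[of "[1..<Suc d]" d "[]" m "count_list xs"]
    by (simp add: basis_word_def atLeastLessThanSuc_atLeastAtMost del: upt_Suc)
qed

subsection \<open>Coordinates in the monomial basis\<close>

text \<open>Members of \<open>gca_exponents\<close> are \<open>undefined\<close> outside
  \<open>{1..d}\<close>, whereas \<open>weight\<close> compares letter counts at every index; those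
  counts are 0 there for words in the letters up to \<open>d\<close>.\<close>

definition residue_vector :: "nat \<Rightarrow> (nat \<Rightarrow> nat) \<Rightarrow> nat \<Rightarrow> nat" where
  "residue_vector d j = (\<lambda>k. if k \<in> {1..d} then j k else 0)"

lemma finite_gca_exponents: "finite (gca_exponents m d)"
  by (simp add: gca_exponents_def finite_PiE)

lemma residue_vector_inject:
  assumes "i \<in> gca_exponents m d" "j \<in> gca_exponents m d"
  shows "residue_vector d i = residue_vector d j \<longleftrightarrow> i = j"
proof
  assume eq: "residue_vector d i = residue_vector d j"
  show "i = j"
  proof (rule PiE_ext[OF assms[unfolded gca_exponents_def]])
    fix k assume "k \<in> {1..d}"
    with fun_cong[OF eq, of k] show "i k = j k" by (simp add: residue_vector_def)
  qed
qed simp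

text \<open>The functionals are dual to the basis words: these are sorted, so they have no
  inversions, and their exponents are already reduced modulo \<open>m\<close>.\<close>

lemma weight_basis_word:
  assumes "0 < m" "i \<in> gca_exponents m d" "j \<in> gca_exponents m d"
  shows "weight m (residue_vector d i) (Word (basis_word d j)) = (if i = j then 1 else 0)"
proof -
  have "j k < m" if "k \<in> {1..d}" for k
    using PiE_mem[OF assms(3)[unfolded gca_exponents_def] that] assms(1) by auto
  then have "(\<lambda>k. count_list (basis_word d j) k mod m) = residue_vector d j"
    by (auto simp: count_basis_word residue_vector_def fun_eq_iff)
  moreover have "inversions (basis_word d j) = 0"
    by (intro inversions_sorted sorted_basis_word)
  ultimately show ?thesis
    using residue_vector_inject[OF assms(2,3)] by (auto simp: weight_def)
qed

lemma basis_word_in_free_alg: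
  "Poly_Mapping.single (Word (basis_word d j)) c \<in> carrier (free_alg d)"
  by (rule single_in_free_alg[OF set_basis_word])

text \<open>The spanning half of the basis property, with explicit coordinates. Both sides are
  additive in \<open>p\<close>, and a single word is reduced by
  \<open>gca_class_word\<close>.\<close>

lemma gca_class_expansion:
  assumes "0 < m" "p \<in> carrier (free_alg d)"
  shows "gca_class m d p = gca_class m d (\<Sum>j\<in>gca_exponents m d.
    Poly_Mapping.single (Word (basis_word d j)) (lin_ext (weight m (residue_vector d j)) p))"
proof -
  let ?E = "\<lambda>p. \<Sum>j\<in>gca_exponents m d.
    Poly_Mapping.single (Word (basis_word d j)) (lin_ext (weight m (residue_vector d j)) p)"
  have E: "?E p \<in> carrier (free_alg d)" for p
    by (intro sum_in_free_alg basis_word_in_free_alg)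
  have "p \<in> carrier (free_alg d) \<and> gca_class m d p = gca_class m d (?E p)"
  proof (induction p rule: poly_mapping_add_induct)
    case zero
    then show ?case by (simp add: zero_in_free_alg)
  next
    case (single w c)
    obtain xs where w: "w = Word xs" by (cases w)
    with single assms(2) have xs: "set xs \<subseteq> {1..d}"
      unfolding carrier_free_alg_iff by fastforce
    \<comment> \<open>The exponents of the one monomial to which the word reduces, restricted so as
      to be extensional; only this term of the sum survives.\<close>
    define j0 where "j0 = (\<lambda>k\<in>{1..d}. count_list xs k mod m)"
    have j0: "j0 \<in> gca_exponents m d"
      using assms(1) unfolding gca_exponents_def j0_def
      by (intro restrict_PiE_iff[THEN iffD2] ballI) (simp add: Suc_le_eq less_Suc_eq_le[symmetric])
    have "(\<lambda>k. count_list xs k mod m) = residue_vector d j0"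
    proof
      fix k
      show "count_list xs k mod m = residue_vector d j0 k"
      proof (cases "k \<in> {1..d}")
        case False
        with xs have "k \<notin> set xs" by blast
        with False show ?thesis by (auto simp: residue_vector_def)
      qed (simp add: residue_vector_def j0_def)
    qed
    then have weight: "weight m (residue_vector d j) w
        = (if j0 = j then inverse (omega m) ^ inversions xs else 0)" if "j \<in> gca_exponents m d" for j
      using residue_vector_inject[OF j0 that] by (simp add: weight_def w)
    have "?E (Poly_Mapping.single w c) = (\<Sum>j\<in>gca_exponents m d. if j0 = j
        then Poly_Mapping.single (Word (basis_word d j)) (c * inverse (omega m) ^ inversions xs)
        else 0)"
      by (rule sum.cong) (simp_all add: weight)
    also have "\<dots> = Poly_Mapping.single (Word (basis_word d j0))
        (c * inverse (omega m) ^ inversions xs)"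
      using j0 by (simp add: finite_gca_exponents)
    also have "basis_word d j0 = basis_word d (\<lambda>k. count_list xs k mod m)"
      by (rule basis_word_cong) (simp add: j0_def)
    finally show ?case
      using gca_class_word[OF xs, of m c] xs by (simp add: w single_in_free_alg)
  next
    case (add q r)
    have "?E (q + r) = ?E q + ?E r"
      by (simp add: lin_ext_add single_add sum.distrib)
    with add show ?case
      using E by (simp add: in_free_alg flip: gca_class_add)
  qed
  then show ?thesis by blast
qed

lemma gca_lincomb_eq:
  "(\<Oplus>\<^bsub>gca m d\<^esub> j \<in> gca_exponents m d. gca_smult m d (u j) (gca_monomial m d j)) =
    gca_class m d (\<Sum>j\<in>gca_exponents m d. Poly_Mapping.single (Word (basis_word d j)) (u j))"
proof -
  have "gca_smult m d (u j) (gca_monomial m d j) =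
      gca_class m d (Poly_Mapping.single (Word (basis_word d j)) (u j))" for j
    unfolding gca_smult_def gca_scalar_def gca_monomial_eq
    by (simp add: gca_class_mult const_in_free_alg basis_word_in_free_alg const_mult_single)
  then show ?thesis
    using gca_class_finsum[OF finite_gca_exponents basis_word_in_free_alg] by simp
qed

text \<open>Existence of the coordinates is \<open>gca_class_expansion\<close>. Uniqueness holds
  since the dual functionals vanish on the ideal and so read each coefficient off any
  expansion.\<close>

lemma gca_coeffs_class:
  assumes "0 < m" "p \<in> carrier (free_alg d)" "j \<in> gca_exponents m d"
  shows "gca_coeffs m d (gca_class m d p) j = lin_ext (weight m (residue_vector d j)) p"
proof -
  \<comment> \<open>The restriction supplies the extensionality demanded in the definition of
    \<open>gca_coeffs\<close>.\<close>
  let ?u = "\<lambda>j\<in>gca_exponents m d. lin_ext (weight m (residue_vector d j)) p"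
  let ?N = "\<lambda>u. \<Sum>j\<in>gca_exponents m d. Poly_Mapping.single (Word (basis_word d j)) (u j)"
  have "gca_coeffs m d (gca_class m d p) = ?u"
    unfolding gca_coeffs_def gca_lincomb_eq
  proof (rule the_equality)
    have "?N ?u = ?N (\<lambda>j. lin_ext (weight m (residue_vector d j)) p)"
      by (rule sum.cong) simp_all
    then show "?u \<in> gca_exponents m d \<rightarrow>\<^sub>E UNIV \<and> gca_class m d p = gca_class m d (?N ?u)"
      using gca_class_expansion[OF assms(1,2)] by simp
  next
    fix u :: "(nat \<Rightarrow> nat) \<Rightarrow> complex"
    assume u: "u \<in> gca_exponents m d \<rightarrow>\<^sub>E UNIV \<and> gca_class m d p = gca_class m d (?N u)"
    have ideal: "p - ?N u \<in> gca_ideal m d"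
      using u by (subst gca_class_eq_iff[symmetric])
        (auto intro: assms(2) sum_in_free_alg basis_word_in_free_alg)
    have "u i = lin_ext (weight m (residue_vector d i)) p" if i: "i \<in> gca_exponents m d" for i
    proof -
      have "lin_ext (weight m (residue_vector d i)) p = lin_ext (weight m (residue_vector d i)) (?N u)"
        using lin_ext_weight_gca_ideal[OF assms(1) ideal] by (simp add: lin_ext_diff)
      also have "\<dots> = (\<Sum>j\<in>gca_exponents m d. if i = j then u j else 0)"
        unfolding lin_ext_sum
        by (rule sum.cong) (simp_all add: weight_basis_word[OF assms(1) i])
      also have "\<dots> = u i"
        using i by (simp add: finite_gca_exponents)
      finally show ?thesis by simp
    qed
    then show "u = ?u"
      using u by (intro extensionalityI[of u "gca_exponents m d"]) (auto simp: PiE_iff)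
  qed
  with assms(3) show ?thesis by simp
qed

lemma grade0_class:
  assumes "0 < m" "p \<in> carrier (free_alg d)"
  shows "grade0 m d (gca_class m d p) = lin_ext (weight m (\<lambda>_. 0)) p"
proof -
  have "(\<lambda>k\<in>{1..d}. 0) \<in> gca_exponents m d"
    by (auto simp: gca_exponents_def)
  moreover have "residue_vector d (\<lambda>k\<in>{1..d}. 0) = (\<lambda>_. 0)"
    by (auto simp: residue_vector_def)
  ultimately show ?thesis
    using gca_coeffs_class[OF assms] by (simp add: grade0_def)
qed

subsection \<open>The underline operation on representatives\<close>

definition free_underline :: "nat \<Rightarrow> (word \<Rightarrow>\<^sub>0 complex) \<Rightarrow> word \<Rightarrow>\<^sub>0 complex" where
  "free_underline m p = const (2 * lin_ext (weight m (\<lambda>_. 0)) p) - p"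

lemma free_underline_in_free_alg:
  "p \<in> carrier (free_alg d) \<Longrightarrow> free_underline m p \<in> carrier (free_alg d)"
  by (simp add: free_underline_def in_free_alg)

lemma underline_class:
  assumes "0 < m" "p \<in> carrier (free_alg d)"
  shows "underline m d (gca_class m d p) = gca_class m d (free_underline m p)"
  using assms
  by (simp add: underline_def gca_scalar_def grade0_class gca_class_minus const_in_free_alg
      free_underline_def)

lemma const_add: "const (a + b) = const a + const b"
  by (simp add: const_def single_add)

lemma const_diff: "const (a - b) = const a - const b"
  by (simp add: const_def single_diff)

lemma const_mult: "const (a * b) = const a * const b"
  by (simp add: const_def mult_single)

lemma lin_ext_weight_const: "lin_ext (weight m (\<lambda>_. 0)) (const c) = c"
  by (simp add: const_def weight_def zero_word_def)

text \<open>The grade 0 part \<open>t\<close> of \<open>p\<close> is preserved, as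
  \<open>2 * t - t = t\<close>, so the two scalars cancel.\<close>

lemma free_underline_involutive: "free_underline m (free_underline m p) = p"
  by (simp add: free_underline_def lin_ext_diff lin_ext_weight_const)

lemma free_underline_add: "free_underline m (p + q) = free_underline m p + free_underline m q"
  by (simp add: free_underline_def lin_ext_add distrib_left const_add)

lemma free_underline_const_mult: "free_underline m (const c * p) = const c * free_underline m p"
  by (simp add: free_underline_def lin_ext_const_mult right_diff_distrib mult.left_commute
      flip: const_mult)

text \<open>The two sides differ by \<open>2 (\<langle>p q\<rangle>\<^sub>0 - \<langle>q p\<rangle>\<^sub>0) p\<close>, which vanishes by the trace property.\<close>

lemma free_underline_mult_assoc:
  assumes "0 < m"
  shows "free_underline m (p * q) * p = p * free_underline m (q * p)"
  using lin_ext_weight_commute[OF assms, of p q]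
  by (simp add: free_underline_def left_diff_distrib right_diff_distrib const_mult_commute[of _ p] mult.assoc)

text \<open>\<open>q\<close> and its underline add up to the scalar \<open>2 * ?t q\<close>, so the
  bracket on the right is the underline of \<open>p\<close> times that scalar. The left side is
  expanded into this form.\<close>

lemma free_underline_mult_underline:
  "free_underline m (p * free_underline m q) =
    (free_underline m p * free_underline m q + free_underline m p * q) - free_underline m (p * q)"
proof -
  let ?t = "lin_ext (weight m (\<lambda>_. 0))"
  have "p * free_underline m q = const (2 * ?t q) * p - p * q"
    by (simp add: free_underline_def right_diff_distrib const_mult_commute[of _ p])
  then have "free_underline m (p * free_underline m q) =
      const (2 * (2 * ?t q * ?t p - ?t (p * q))) - (const (2 * ?t q) * p - p * q)"
    by (simp add: free_underline_def lin_ext_diff lin_ext_const_mult)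
  \<comment> \<open>The scalar is split so that its first part combines with
    \<open>p * const (2 * ?t q)\<close> and its second with \<open>p * q\<close>.\<close>
  also have "const (2 * (2 * ?t q * ?t p - ?t (p * q))) =
      const (2 * ?t p) * const (2 * ?t q) - const (2 * ?t (p * q))"
    by (simp add: right_diff_distrib mult_ac flip: const_mult const_diff)
  also have "const (2 * ?t q) * p = p * const (2 * ?t q)"
    by (rule const_mult_commute)
  also have "const (2 * ?t p) * const (2 * ?t q) - const (2 * ?t (p * q))
        - (p * const (2 * ?t q) - p * q)
      = (const (2 * ?t p) - p) * const (2 * ?t q) - (const (2 * ?t (p * q)) - p * q)"
    by (simp add: left_diff_distrib)
  also have "\<dots> = free_underline m p * (free_underline m q + q) - free_underline m (p * q)"
    by (simp add: free_underline_def)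
  finally show ?thesis by (simp add: distrib_left)
qed

theorem theorem7p7:
  fixes m d :: nat
    and A (structure)
    and U V :: "(word \<Rightarrow>\<^sub>0 complex) set"
    and \<alpha> :: complex
  assumes "2 \<le> m" and "1 \<le> d"
    and "A = gca m d"
    and "U \<in> carrier A" and "V \<in> carrier A"
  shows "underline m d (underline m d U) = U \<and>
    underline m d (U \<oplus> V) = underline m d U \<oplus> underline m d V \<and>
    underline m d (gca_smult m d \<alpha> U) = gca_smult m d \<alpha> (underline m d U) \<and>
    underline m d (U \<otimes> V) \<otimes> U = U \<otimes> underline m d (V \<otimes> U) \<and>
    underline m d (U \<otimes> underline m d V) =
      (underline m d U \<otimes> underline m d V \<oplus> underline m d U \<otimes> V) \<ominus> underline m d (U \<otimes> V)"
  using assms(4) unfolding assms(3)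
proof (rule gca_class_cases)
  fix p assume p: "p \<in> carrier (free_alg d)" and U: "U = gca_class m d p"
  from assms(5) obtain q where q: "q \<in> carrier (free_alg d)" and V: "V = gca_class m d q"
    unfolding assms(3) by (rule gca_class_cases)
  have m: "0 < m" using assms(1) by simp
  \<comment> \<open>Every operation on classes is carried over to the representatives
    \<open>p\<close> and \<open>q\<close>, where the identities of the free algebra apply.\<close>
  note simps = U V p q underline_class[OF m] gca_class_mult gca_class_add gca_class_minus
    in_free_alg free_underline_in_free_alg gca_smult_def gca_scalar_def
  show "underline m d (underline m d U) = U \<and>
    underline m d (U \<oplus>\<^bsub>gca m d\<^esub> V) = underline m d U \<oplus>\<^bsub>gca m d\<^esub> underline m d V \<and>
    underline m d (gca_smult m d \<alpha> U) = gca_smult m d \<alpha> (underline m d U) \<and>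
    underline m d (U \<otimes>\<^bsub>gca m d\<^esub> V) \<otimes>\<^bsub>gca m d\<^esub> U = U \<otimes>\<^bsub>gca m d\<^esub> underline m d (V \<otimes>\<^bsub>gca m d\<^esub> U) \<and>
    underline m d (U \<otimes>\<^bsub>gca m d\<^esub> underline m d V) =
      (underline m d U \<otimes>\<^bsub>gca m d\<^esub> underline m d V \<oplus>\<^bsub>gca m d\<^esub> underline m d U \<otimes>\<^bsub>gca m d\<^esub> V)
        \<ominus>\<^bsub>gca m d\<^esub> underline m d (U \<otimes>\<^bsub>gca m d\<^esub> V)"
    by (simp add: simps free_underline_involutive free_underline_add free_underline_const_mult
        free_underline_mult_assoc[OF m] free_underline_mult_underline[of m p q])
qed

end
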